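(* Fix an integer $n \geq 2$. There is a constant $C_n$ depending only on $n$ such that, for all sufficiently large $m$, the expected number of facets of $P \sim P(n,m)$ is at most $$C_n (\log m)^{n-1}\, m .$$
   Context: $P(n,m)$ denotes the probability distribution on polytopes in $\mathbb{R}^n$ in which $P \sim P(n,m)$ is the convex hull of $m$ points $a_1,\dots,a_m$ chosen independently and uniformly at random from the unit sphere $S^{n-1} = \{x \in \mathbb{R}^n : \|x\| = 1\}$. A facet of $P$ is an $(n-1)$-dimensional face. *)

theory Defs
  imports "HOL-Probability.Probability"
begin

(* The uniform distribution on the unit sphere, i.e. normalised surface measure, as the cone
   measure: the probability of A is the volume of the part of the unit ball lying in the cone
   over A, divided by the volume of the ball (lemma emeasure_uniform_sphere).  It is the
   unique rotation-invariant Borel probability measure concentrated on the sphere; these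
   properties (not the uniqueness) are checked below. *)
definition uniform_sphere :: "(real ^ 'n) measure" where
  "uniform_sphere = distr (uniform_measure lborel (ball 0 1)) borel (\<lambda>x. x /\<^sub>R norm x)"

definition uniform_sphere_sample :: "nat \<Rightarrow> (nat \<Rightarrow> real ^ 'n) measure" where
  "uniform_sphere_sample m = PiM {..<m} (\<lambda>_. uniform_sphere)"

(* The library's facet_of measures codimension relative to the affine hull of P.  Here a facet is a
   face of dimension n - 1, with n the dimension of the ambient space; for full-dimensional P the
   two notions agree. *)
definition facets :: "(real ^ 'n) set \<Rightarrow> (real ^ 'n) set set" where
  "facets P = {F. F face_of P \<and> aff_dim F = int CARD('n) - 1}"

lemma finite_facets: "polytope P \<Longrightarrow> finite (facets P)"
  unfolding facets_def by (rule finite_subset[OF _ finite_polytope_faces]) auto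

lemma facets_eq_facet_of:
  fixes P :: "(real ^ 'n) set"
  assumes "aff_dim P = int CARD('n)"
  shows "facets P = {F. F facet_of P}"
proof -
  have "F \<noteq> {}" if "aff_dim F = int CARD('n) - 1" for F :: "(real ^ 'n) set"
    using that by (auto simp: aff_dim_empty)
  then show ?thesis
    using assms by (auto simp: facets_def facet_of_def)
qed

lemma measurable_normalize:
  "(\<lambda>x. x /\<^sub>R norm x) \<in> borel \<rightarrow>\<^sub>M (borel :: (real ^ 'n) measure)"
  by measurable

lemma emeasure_unit_ball:
  "emeasure lborel (ball 0 1 :: (real ^ 'n) set) \<noteq> 0"
  "emeasure lborel (ball 0 1 :: (real ^ 'n) set) \<noteq> \<infinity>"
  using emeasure_lborel_ball_finite[of "0 :: real ^ 'n" 1]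
    content_ball_pos[of 1 "0 :: real ^ 'n"]
  by (auto simp: measure_def)

lemma sets_uniform_sphere [simp, measurable_cong]: "sets uniform_sphere = sets borel"
  by (simp add: uniform_sphere_def)

lemma space_uniform_sphere [simp]: "space uniform_sphere = UNIV"
  by (simp add: uniform_sphere_def)

lemma emeasure_uniform_sphere:
  fixes A :: "(real ^ 'n) set"
  assumes "A \<in> sets borel"
  shows "emeasure uniform_sphere A =
    emeasure lborel {x \<in> ball 0 1. x /\<^sub>R norm x \<in> A} / emeasure lborel (ball 0 1 :: (real ^ 'n) set)"
proof -
  have *: "(\<lambda>x. x /\<^sub>R norm x) -` A \<in> sets (borel :: (real ^ 'n) measure)"
    using measurable_sets[OF measurable_normalize assms] by simp
  have "emeasure uniform_sphere A =
      emeasure (uniform_measure lborel (ball 0 1)) ((\<lambda>x. x /\<^sub>R norm x) -` A)"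
    unfolding uniform_sphere_def using assms by (subst emeasure_distr) auto
  also have "\<dots> = emeasure lborel (ball 0 1 \<inter> ((\<lambda>x. x /\<^sub>R norm x) -` A))
      / emeasure lborel (ball 0 1 :: (real ^ 'n) set)"
    using * by (subst emeasure_uniform_measure) auto
  also have "ball 0 1 \<inter> ((\<lambda>x. x /\<^sub>R norm x) -` A) = {x \<in> ball 0 1. x /\<^sub>R norm x \<in> A}"
    by auto
  finally show ?thesis .
qed

lemma prob_space_uniform_sphere: "prob_space (uniform_sphere :: (real ^ 'n) measure)"
proof -
  interpret prob_space "uniform_measure lborel (ball 0 1 :: (real ^ 'n) set)"
    using emeasure_unit_ball by (rule prob_space_uniform_measure)
  show ?thesis
    unfolding uniform_sphere_def by (rule prob_space_distr) simp
qed

lemma AE_uniform_sphere: "AE x in (uniform_sphere :: (real ^ 'n) measure). x \<in> sphere 0 1"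
proof -
  have "AE x in lborel. x \<noteq> (0 :: real ^ 'n)"
    by (rule AE_lborel_singleton)
  then have "AE x in lborel. x \<in> ball 0 1 \<longrightarrow> x /\<^sub>R norm x \<in> sphere (0 :: real ^ 'n) 1"
    by eventually_elim simp
  then have "AE x in uniform_measure lborel (ball 0 1). x /\<^sub>R norm x \<in> sphere (0 :: real ^ 'n) 1"
    by (intro AE_uniform_measureI) auto
  then show ?thesis
    unfolding uniform_sphere_def by (subst AE_distr_iff) auto
qed

(* The sort wellorder is inherited from measure_orthogonal_image. *)
lemma uniform_sphere_rotation_invariant:
  fixes T :: "real ^ 'n :: {finite, wellorder} \<Rightarrow> real ^ 'n :: {finite, wellorder}"
  assumes T: "orthogonal_transformation T"
  shows "distr uniform_sphere borel T = uniform_sphere"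
proof (rule measure_eqI)
  fix A assume "A \<in> sets (distr uniform_sphere borel T)"
  then have A: "A \<in> sets borel" by simp
  have lin: "linear T" and nrm: "\<And>x. norm (T x) = norm x" and bij: "bij T"
    using T by (auto simp: orthogonal_transformation_linear orthogonal_transformation_norm
        orthogonal_transformation_bij)
  have T_meas [measurable]: "T \<in> borel \<rightarrow>\<^sub>M borel"
    using lin by (intro borel_measurable_continuous_onI linear_continuous_on)
      (simp add: linear_conv_bounded_linear)
  have TA: "T -` A \<in> sets borel"
    using measurable_sets[OF T_meas A] by simp
  define S where "S B = {x \<in> ball 0 1. x /\<^sub>R norm x \<in> B}" for B :: "(real ^ 'n :: {finite, wellorder}) set"
  have S_borel: "S B \<in> sets borel" if B: "B \<in> sets borel" for B
  proof -
    have "ball 0 1 \<inter> ((\<lambda>x. x /\<^sub>R norm x) -` B) \<in> sets (borel :: (real ^ 'n :: {finite, wellorder}) measure)"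
      using measurable_sets[OF measurable_normalize B] by auto
    moreover have "S B = ball 0 1 \<inter> ((\<lambda>x. x /\<^sub>R norm x) -` B)"
      by (auto simp: S_def)
    ultimately show ?thesis by simp
  qed
  have S_fin: "emeasure lborel (S B) \<noteq> \<infinity>" if "B \<in> sets borel" for B
  proof -
    have "S B \<subseteq> ball 0 1" by (auto simp: S_def)
    then have "emeasure lborel (S B) \<le> emeasure lborel (ball 0 1 :: (real ^ 'n :: {finite, wellorder}) set)"
      by (intro emeasure_mono) auto
    then show ?thesis
      using emeasure_unit_ball(2) by (auto simp: top_unique)
  qed
  have S_lm: "S B \<in> lmeasurable" if "B \<in> sets borel" for B
    using S_fin[OF that] S_borel[OF that] by (auto simp: fmeasurable_def less_top)
  have "T ` S (T -` A) = S A"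
  proof (intro equalityI subsetI)
    fix y assume "y \<in> S A"
    moreover obtain x where "y = T x" using bij by (metis bij_pointE)
    ultimately show "y \<in> T ` S (T -` A)"
      by (auto simp: S_def nrm linear_cmul[OF lin])
  qed (auto simp: S_def nrm linear_cmul[OF lin])
  then have "measure lebesgue (S (T -` A)) = measure lebesgue (S A)"
    using measure_orthogonal_image[OF T S_lm[OF TA]] by simp
  then have "measure lborel (S (T -` A)) = measure lborel (S A)"
    using S_borel A TA by (simp add: measure_completion)
  then have "emeasure lborel (S (T -` A)) = emeasure lborel (S A)"
    using S_fin A TA by (simp add: emeasure_eq_ennreal_measure)
  moreover have "emeasure (distr uniform_sphere borel T) A = emeasure uniform_sphere (T -` A)"
    using A by (subst emeasure_distr) auto
  ultimately show "emeasure (distr uniform_sphere borel T) A = emeasure uniform_sphere A"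
    using emeasure_uniform_sphere[OF TA] emeasure_uniform_sphere[OF A] by (simp add: S_def)
qed simp

end

theory Submission
  imports Defs "HOL-Real_Asymp.Real_Asymp"
begin

text \<open>
  Write $n$ for the dimension and let $N$ be an integer of order $(m / \log m)^{1/(n-1)}$.  Caps of
  radius $1/N$ have measure of order $N^{1-n}$, so a union bound over a polynomial-size net shows
  that, up to probability $m^{-n}$, every point of the sphere has a sample point within distance
  $3/N$.  In that case let $c$ be the outer unit normal of a facet.  The vertices of the facet
  maximise $x \mapsto c \cdot x$ over the sample, i.e. they are the sample points closest to $c$, so they
  lie within $3/N$ of $c$ and within $6/N$ of each other.  A facet is determined by $n$ of its
  vertices, and the expected number of $n$-tuples of sample points that all lie within $6/N$ of the
  first is at most $m \cdot (m \cdot O(N^{1-n}))^{n-1} = m \cdot O(\log m)^{n-1}$.  In the exceptional event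
  the trivial bound $m^n$ suffices.
\<close>

section \<open>Measure of spherical caps\<close>

lemma ball_fmeasurable_lborel: "ball c r \<in> fmeasurable (lborel :: 'a::euclidean_space measure)"
  by (rule fmeasurableI) (use emeasure_lborel_ball_finite[of c r] in \<open>auto simp: less_top\<close>)

text \<open>Stated without division, so that a comparison of cone volumes becomes a comparison of
  cap measures once the volume of the unit ball is cancelled.\<close>

lemma measure_uniform_sphere_cone:
  fixes A :: "(real ^ 'n) set"
  assumes "A \<in> sets borel"
  shows "measure uniform_sphere A * measure lborel (ball 0 1 :: (real ^ 'n) set) =
    measure lborel {x \<in> ball 0 1. x /\<^sub>R norm x \<in> A}"
    and "{x \<in> ball 0 1. x /\<^sub>R norm x \<in> A} \<in> fmeasurable lborel"
proof -
  let ?S = "{x \<in> ball 0 1. x /\<^sub>R norm x \<in> A}"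
  have "?S = ball 0 1 \<inter> ((\<lambda>x. x /\<^sub>R norm x) -` A)"
    by auto
  then have "?S \<in> sets lborel"
    using measurable_sets[OF measurable_normalize assms] by auto
  then show fm: "?S \<in> fmeasurable lborel"
    by (rule fmeasurableI2[OF ball_fmeasurable_lborel[of 0 1], rotated]) auto
  have "emeasure uniform_sphere A =
      ennreal (measure lborel ?S) / ennreal (measure lborel (ball 0 1 :: (real ^ 'n) set))"
    using fm emeasure_unit_ball(2)[where 'n='n]
    by (simp add: emeasure_uniform_sphere[OF assms] emeasure_eq_measure2 emeasure_eq_ennreal_measure)
  also have "\<dots> = ennreal (measure lborel ?S / measure lborel (ball 0 1 :: (real ^ 'n) set))"
    by (simp add: divide_ennreal content_ball_pos)
  finally have "measure uniform_sphere A = measure lborel ?S / measure lborel (ball 0 1 :: (real ^ 'n) set)"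
    by (simp add: measure_def)
  then show "measure uniform_sphere A * measure lborel (ball 0 1 :: (real ^ 'n) set) = measure lborel ?S"
    using content_ball_pos[of 1 "0 :: real ^ 'n"] by simp
qed

text \<open>
  The cone over a cap with centre $c$ is covered by balls centred at the points $(j/N) c$; for the
  lower bound, such balls are packed into it.
\<close>

lemma measure_uniform_sphere_ball_le:
  fixes c :: "real ^ 'n"
  assumes c: "norm c = 1" and N: "N > 0" and r: "r \<ge> 0"
  shows "measure uniform_sphere (ball c (r / real N)) \<le>
    (real N + 1) * ((r + 1) / real N) ^ CARD('n)"
proof -
  let ?S = "{x \<in> ball 0 1. x /\<^sub>R norm x \<in> ball c (r / real N)}"
  let ?B = "\<lambda>j::nat. ball ((real j / real N) *\<^sub>R c) ((r + 1) / real N)"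
  let ?v = "measure lborel (ball 0 1 :: (real ^ 'n) set)"
  have "?S \<subseteq> (\<Union>j\<le>N. ?B j)"
  proof
    fix x assume x: "x \<in> ?S"
    \<comment> \<open>Rounding norm x down to a multiple of 1/N costs less than 1/N in distance;
      this is the 1 in r + 1. The indices j = 0, ..., N account for the factor N + 1.\<close>
    define j where "j = nat \<lfloor>norm x * real N\<rfloor>"
    have j: "real j \<le> norm x * real N" "norm x * real N < real j + 1"
      unfolding j_def by (auto simp: of_nat_nat)
    have x1: "norm x < 1" using x by simp
    have "norm x * real N \<le> real N" using x1 N by (simp add: mult_left_le_one_le)
    then have "j \<le> N" using j by linarith
    have "norm ((real j / real N) *\<^sub>R c - x) \<le> norm ((real j / real N) *\<^sub>R c - norm x *\<^sub>R c) + norm (norm x *\<^sub>R c - x)"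
      by (rule norm_diff_triangle_ineq[THEN order_trans[rotated]]) simp
    also have "norm ((real j / real N) *\<^sub>R c - norm x *\<^sub>R c) = \<bar>real j / real N - norm x\<bar>"
      by (simp add: c flip: scaleR_left_diff_distrib)
    also have "\<dots> < 1 / real N"
    proof -
      have "real j / real N \<le> norm x" "norm x < real j / real N + 1 / real N"
        using j N by (simp_all add: divide_le_eq less_divide_eq flip: add_divide_distrib)
      then show ?thesis using N by (simp add: abs_less_iff)
    qed
    \<comment> \<open>Scaling by norm x, which is below 1, only shrinks the distance between c and
      the normalised x. The origin is separate because it normalises to 0.\<close>
    also have "norm (norm x *\<^sub>R c - x) \<le> r / real N"
    proof (cases "x = 0")
      case False
      have "norm (norm x *\<^sub>R c - x) = norm (norm x *\<^sub>R (c - x /\<^sub>R norm x))"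
        using False by (simp add: scaleR_diff_right)
      also have "\<dots> = norm x * dist c (x /\<^sub>R norm x)"
        by (simp add: dist_norm)
      also have "\<dots> \<le> 1 * (r / real N)"
        using x x1 by (intro mult_mono) auto
      finally show ?thesis by simp
    qed (use r in simp)
    finally have "dist ((real j / real N) *\<^sub>R c) x < (r + 1) / real N"
      by (simp add: dist_norm add_divide_distrib)
    then show "x \<in> (\<Union>j\<le>N. ?B j)"
      using \<open>j \<le> N\<close> by auto
  qed
  then have "measure lborel ?S \<le> measure lborel (\<Union>j\<le>N. ?B j)"
    using measure_uniform_sphere_cone(2)[of "ball c (r / real N)"]
    by (intro measure_mono_fmeasurable) (auto intro!: fmeasurable.finite_UN ball_fmeasurable_lborel)
  also have "\<dots> \<le> (\<Sum>j\<le>N. measure lborel (?B j))"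
    by (intro measure_UNION_le) auto
  also have "\<dots> = (real N + 1) * ((r + 1) / real N) ^ CARD('n) * ?v"
    using r by (subst content_ball_conv_unit_ball) auto
  also have "measure lborel ?S = measure uniform_sphere (ball c (r / real N)) * ?v"
    by (rule measure_uniform_sphere_cone(1)[symmetric]) simp
  finally have "measure uniform_sphere (ball c (r / real N)) * ?v \<le>
    (real N + 1) * ((r + 1) / real N) ^ CARD('n) * ?v" .
  then show ?thesis
    by (rule mult_right_le_imp_le) (simp add: content_ball_pos)
qed

lemma measure_uniform_sphere_ball_ge:
  fixes c :: "real ^ 'n"
  assumes c: "norm c = 1" and N: "N > 0"
  shows "real N * (1 / (4 * real N)) ^ CARD('n) \<le> measure uniform_sphere (ball c (1 / real N))"
proof -
  let ?S = "{x \<in> ball 0 1. x /\<^sub>R norm x \<in> ball c (1 / real N)}"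
  let ?\<rho> = "1 / (4 * real N)"
  \<comment> \<open>The centres run along the ray from 1/2 to 1 - 1/(2N), one diameter apart: the
    open balls are disjoint and stay in the unit ball. At height t at least 1/2, an error of 1/(2N)
    grows to at most 1/N when normalised.\<close>
  let ?s = "\<lambda>j::nat. 1 / 2 + 2 * real j * ?\<rho>"
  let ?B = "\<lambda>j::nat. ball (?s j *\<^sub>R c) ?\<rho>"
  let ?v = "measure lborel (ball 0 1 :: (real ^ 'n) set)"
  have sub: "?B j \<subseteq> ?S" if "j < N" for j
  proof
    fix y assume y: "y \<in> ?B j"
    define t where "t = ?s j"
    have "real j + 1 \<le> real N" using that by linarith
    then have t: "t \<ge> 1 / 2" "t + ?\<rho> \<le> 1"
      unfolding t_def using N by (auto simp: field_simps)
    have d: "norm (y - t *\<^sub>R c) < ?\<rho>"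
      using y by (simp add: dist_norm norm_minus_commute t_def)
    have nt: "norm (t *\<^sub>R c) = t" using t c by simp
    have ab: "\<bar>norm y - t\<bar> < ?\<rho>"
      using norm_triangle_ineq3[of y "t *\<^sub>R c"] d nt by linarith
    have rho: "?\<rho> \<le> 1 / 4" using N by (simp add: field_simps)
    have y0: "norm y > 0" using ab t rho by linarith
    \<comment> \<open>At height t, the vector t c is compared with the point of norm t on the ray
      through y. Both lie within 1/(4N) of y: the first by the choice of y, the second because norm
      y is that close to t.\<close>
    have "norm (y /\<^sub>R norm y - c) * t \<le> norm ((t / norm y) *\<^sub>R y - y) + norm (y - t *\<^sub>R c)"
    proof -
      have "norm (y /\<^sub>R norm y - c) * t = norm (t *\<^sub>R (y /\<^sub>R norm y - c))"
        using t by simp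
      also have "\<dots> = norm (((t / norm y) *\<^sub>R y - y) + (y - t *\<^sub>R c))"
        by (simp add: scaleR_diff_right divide_inverse)
      also have "\<dots> \<le> norm ((t / norm y) *\<^sub>R y - y) + norm (y - t *\<^sub>R c)"
        by (rule norm_triangle_ineq)
      finally show ?thesis .
    qed
    also have "norm ((t / norm y) *\<^sub>R y - y) = norm ((t / norm y - 1) *\<^sub>R y)"
      by (simp add: scaleR_diff_left)
    also have "\<dots> = \<bar>(t / norm y - 1) * norm y\<bar>"
      by (simp add: abs_mult)
    also have "(t / norm y - 1) * norm y = t - norm y"
      using y0 by (simp add: field_simps)
    finally have "norm (y /\<^sub>R norm y - c) * t < 2 * ?\<rho>"
      using ab d by linarith
    also have "2 * ?\<rho> \<le> 1 / real N * t"
      using mult_left_mono[OF t(1), of "1 / real N"] by simp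
    finally have "dist c (y /\<^sub>R norm y) < 1 / real N"
      using t by (subst dist_commute) (auto simp: dist_norm intro: mult_right_less_imp_less)
    moreover have "norm y < 1" using ab t by linarith
    ultimately show "y \<in> ?S" by simp
  qed
  have disj: "disjoint_family_on ?B {..<N}"
    unfolding disjoint_family_on_def
  proof (intro ballI impI)
    fix i j :: nat assume "i \<noteq> j"
    then have ij: "\<bar>real i - real j\<bar> \<ge> 1" by linarith
    have "dist (?s i *\<^sub>R c) (?s j *\<^sub>R c) = \<bar>?s i - ?s j\<bar>"
      by (simp add: dist_norm c flip: scaleR_left_diff_distrib)
    also have "?s i - ?s j = (real i - real j) * (2 * ?\<rho>)"
      by (simp add: left_diff_distrib diff_divide_distrib)
    also have "\<bar>\<dots>\<bar> \<ge> 1 * (2 * ?\<rho>)"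
      using ij by (simp only: abs_mult) (intro mult_mono, auto)
    finally show "?B i \<inter> ?B j = {}"
      by (intro disjoint_ballI) simp
  qed
  have "real N * ?\<rho> ^ CARD('n) * ?v = (\<Sum>j<N. measure lborel (?B j))"
    by (subst content_ball_conv_unit_ball) auto
  also have "\<dots> = measure lborel (\<Union>j<N. ?B j)"
    using disj fmeasurableD2[OF ball_fmeasurable_lborel]
    by (intro measure_finite_Union[symmetric]) (simp_all add: image_subset_iff)
  also have "\<dots> \<le> measure lborel ?S"
    using sub measure_uniform_sphere_cone(2)[of "ball c (1 / real N)"]
    by (intro measure_mono_fmeasurable) auto
  finally have "real N * ?\<rho> ^ CARD('n) * ?v \<le> measure uniform_sphere (ball c (1 / real N)) * ?v"
    by (simp only: measure_uniform_sphere_cone(1) borel_open open_ball)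
  then show ?thesis
    by (rule mult_right_le_imp_le) (simp add: content_ball_pos)
qed

section \<open>Supporting hyperplanes and spanning vertices of facets\<close>

text \<open>Since \<open>facets\<close> takes the dimension relative to the ambient space, F may be
  all of a flat P; its affine hull is then the hyperplane. Otherwise F is exposed because P is a
  polyhedron. The normal is scaled to a point of the sphere, where density of the sample can be
  applied.\<close>

lemma facet_supporting_hyperplane:
  fixes P :: "(real ^ 'n) set"
  assumes P: "polytope P" and F: "F \<in> facets P" and n: "CARD('n) \<ge> 2"
  obtains c b where "norm c = 1" "\<And>x. x \<in> P \<Longrightarrow> c \<bullet> x \<le> b" "\<And>x. x \<in> F \<Longrightarrow> c \<bullet> x = b"
proof -
  have face: "F face_of P" and dim: "aff_dim F = int CARD('n) - 1"
    using F by (auto simp: facets_def)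
  have "\<exists>a b. a \<noteq> 0 \<and> P \<subseteq> {x. a \<bullet> x \<le> b} \<and> F \<subseteq> {x. a \<bullet> x = b}"
  proof (cases "F = P")
    case True
    then obtain a b where "a \<noteq> 0" "affine hull P = {x. a \<bullet> x = b}"
      using dim aff_dim_eq_hyperplane[of P] by auto
    then show ?thesis
      using True hull_subset[of P affine] by (intro exI[of _ a] exI[of _ b]) auto
  next
    case False
    have "F exposed_face_of P"
      using face P by (simp add: exposed_face_of_polyhedron polytope_imp_polyhedron)
    moreover have "F \<noteq> {}" using dim by auto
    ultimately show ?thesis using False unfolding exposed_face_of by blast
  qed
  then obtain a b where ab: "a \<noteq> 0" "P \<subseteq> {x. a \<bullet> x \<le> b}" "F \<subseteq> {x. a \<bullet> x = b}"
    by blast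
  show ?thesis
  proof (rule that[of "a /\<^sub>R norm a" "b / norm a"])
    show "norm (a /\<^sub>R norm a) = 1" using ab by simp
  qed (use ab in \<open>auto simp: field_simps\<close>)
qed

text \<open>A face of a hull is the hull of some of the generators, and an affine basis chosen among
  them has n elements. A face is cut out by its affine hull, so F can be recovered from I, and
  counting facets reduces to counting index sets.\<close>

lemma facet_spanning_indices:
  fixes a :: "'i \<Rightarrow> real ^ 'n"
  assumes "finite K" and F: "F \<in> facets (convex hull (a ` K))"
  obtains I where "I \<subseteq> K" "card I = CARD('n)" "a ` I \<subseteq> F"
    "F = affine hull (a ` I) \<inter> convex hull (a ` K)"
proof -
  have face: "F face_of convex hull (a ` K)" and dim: "aff_dim F = int CARD('n) - 1"
    using F by (auto simp: facets_def)
  obtain A where A: "A \<subseteq> a ` K" "F = convex hull A"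
    using face_of_convex_hull_subset[OF _ face] assms(1) by (auto intro: finite_imp_compact)
  obtain B where B: "B \<subseteq> A" "\<not> affine_dependent B" "affine hull A = affine hull B"
    using affine_basis_exists by blast
  have "aff_dim F = aff_dim A" using A by (simp add: aff_dim_convex_hull)
  then have "card B = CARD('n)"
    using aff_dim_unique[of B A] B dim by auto
  \<comment> \<open>The family \<open>a\<close> may repeat points; indices on which it is injective
    keep the cardinality of the basis.\<close>
  moreover obtain I where I: "I \<subseteq> K" "inj_on a I" "B = a ` I"
    using A(1) B(1) by (metis subset_image_inj subset_trans)
  ultimately have "card I = CARD('n)" by (simp add: card_image)
  moreover have "F = affine hull F \<inter> convex hull (a ` K)"
    using face by (intro face_of_imp_eq_affine_Int) auto
  then have "F = affine hull (a ` I) \<inter> convex hull (a ` K)"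
    using A B I by (simp add: affine_hull_convex_hull)
  moreover have "a ` I \<subseteq> F"
    using A B I hull_subset[of A convex] by auto
  ultimately show ?thesis using that I by blast
qed

section \<open>A finite net of the unit ball\<close>

text \<open>A cubic grid of spacing 1/(nN): rounding moves each of the n coordinates by at most
  1/(nN), and the l1 norm dominates the Euclidean one. Grid points may lie outside the ball.\<close>

lemma unit_ball_net:
  assumes N: "N > (0 :: nat)"
  obtains G :: "(real ^ 'n) set" where "finite G" "card G \<le> (2 * CARD('n) * N + 1) ^ CARD('n)"
    "\<And>x. norm x \<le> 1 \<Longrightarrow> \<exists>g\<in>G. dist g x \<le> 1 / real N"
proof -
  let ?K = "CARD('n) * N"
  define S where "S = (PiE UNIV (\<lambda>_. {- int ?K..int ?K}) :: ('n \<Rightarrow> int) set)"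
  define v where "v j = (\<chi> i. real_of_int (j i) / real ?K)" for j :: "'n \<Rightarrow> int"
  have K: "real ?K > 0" using N by simp
  show ?thesis
  proof (rule that[of "v ` S"])
    show fin: "finite (v ` S)" by (simp add: S_def finite_PiE)
    have "card (v ` S) \<le> card S" by (rule card_image_le) (simp add: S_def finite_PiE)
    also have "card S = (2 * CARD('n) * N + 1) ^ CARD('n)"
    proof -
      have "card {- int ?K..int ?K} = 2 * CARD('n) * N + 1"
        by (subst card_atLeastAtMost_int) linarith
      then show ?thesis by (simp only: S_def card_PiE finite prod_constant)
    qed
    finally show "card (v ` S) \<le> (2 * CARD('n) * N + 1) ^ CARD('n)" .
    fix x :: "real ^ 'n" assume x: "norm x \<le> 1"
    define j where "j i = \<lfloor>x $ i * real ?K\<rfloor>" for i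
    have "j \<in> S"
    proof -
      have "j i \<in> {- int ?K..int ?K}" for i
      proof -
        have "\<bar>x $ i\<bar> \<le> 1" using component_le_norm_cart[of x i] x by linarith
        then have "\<bar>x $ i * real ?K\<bar> \<le> 1 * real ?K"
          unfolding abs_mult by (intro mult_mono) auto
        then have "- real ?K \<le> x $ i * real ?K" "x $ i * real ?K \<le> real ?K" by linarith+
        then have "- int ?K \<le> j i" "j i \<le> int ?K"
          unfolding j_def by (simp_all only: le_floor_iff floor_le_iff of_int_minus of_int_of_nat_eq)
        then show ?thesis by simp
      qed
      then show ?thesis unfolding S_def by auto
    qed
    moreover have "dist (v j) x \<le> 1 / real N"
    proof -
      have "\<bar>(v j - x) $ i\<bar> \<le> 1 / real ?K" for i
      proof -
        have "real_of_int (j i) \<le> x $ i * real ?K" "x $ i * real ?K \<le> real_of_int (j i) + 1"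
          unfolding j_def by linarith+
        then have "real_of_int (j i) / real ?K \<le> x $ i"
            "x $ i \<le> real_of_int (j i) / real ?K + 1 / real ?K"
          using K by (simp_all only: divide_le_eq le_divide_eq flip: add_divide_distrib) auto
        moreover have "0 \<le> 1 / real ?K" by simp
        ultimately show ?thesis
          by (simp only: v_def vector_minus_component vec_lambda_beta)
      qed
      then have "norm (v j - x) \<le> (\<Sum>i\<in>(UNIV :: 'n set). 1 / real ?K)"
        by (intro order_trans[OF norm_le_l1_cart] sum_mono)
      then show ?thesis using N by (simp add: dist_norm)
    qed
    ultimately show "\<exists>g\<in>v ` S. dist g x \<le> 1 / real N" by blast
  qed
qed

section \<open>Counting facets by index sets\<close>

text \<open>One index is marked so that closeness is only asked relative to its point: once that
  point is fixed, the conditions on the others are independent.\<close>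

definition pointed_index_sets :: "nat \<Rightarrow> nat \<Rightarrow> (nat \<times> nat set) set" where
  "pointed_index_sets m k = Sigma {..<m} (\<lambda>i. {J. J \<subseteq> {..<m} - {i} \<and> card J = k})"

lemma finite_pointed_index_sets: "finite (pointed_index_sets m k)"
  unfolding pointed_index_sets_def by (intro finite_SigmaI) auto

lemma card_pointed_index_sets_le: "card (pointed_index_sets m k) \<le> m ^ Suc k"
proof -
  have "card {J. J \<subseteq> {..<m} - {i} \<and> card J = k} \<le> m ^ k" if "i < m" for i
  proof -
    have "card {J. J \<subseteq> {..<m} - {i} \<and> card J = k} = (m - 1) choose k"
      using that by (subst n_subsets) auto
    also have "\<dots> \<le> ((m - 1) choose k) * fact k" by simp
    also have "\<dots> \<le> (m - 1) ^ k" by (rule binomial_fact_pow)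
    also have "\<dots> \<le> m ^ k" by (intro power_mono) auto
    finally show ?thesis .
  qed
  then have "(\<Sum>i<m. card {J. J \<subseteq> {..<m} - {i} \<and> card J = k}) \<le> (\<Sum>i<m. m ^ k)"
    by (intro sum_mono) auto
  then show ?thesis
    unfolding pointed_index_sets_def by (subst card_SigmaI) auto
qed

text \<open>Every facet is the image of a spanning index set with any one element marked. The
  relation \<open>Q\<close> is left open because two instances are used: closeness when the sample
  is dense, and the always true relation for the trivial bound.\<close>

lemma card_facets_le:
  fixes a :: "nat \<Rightarrow> real ^ 'n"
  assumes "\<And>F i j. F \<in> facets (convex hull (a ` {..<m})) \<Longrightarrow> i < m \<Longrightarrow> j < m \<Longrightarrow>
    a i \<in> F \<Longrightarrow> a j \<in> F \<Longrightarrow> Q i j"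
  shows "card (facets (convex hull (a ` {..<m}))) \<le>
    card {(i, J) \<in> pointed_index_sets m (CARD('n) - 1). \<forall>j\<in>J. Q i j}"
proof -
  let ?P = "convex hull (a ` {..<m})"
  let ?T = "{(i, J) \<in> pointed_index_sets m (CARD('n) - 1). \<forall>j\<in>J. Q i j}"
  let ?h = "\<lambda>(i, J). affine hull (a ` insert i J) \<inter> ?P"
  have "facets ?P \<subseteq> ?h ` ?T"
  proof
    fix F assume F: "F \<in> facets ?P"
    obtain I where I: "I \<subseteq> {..<m}" "card I = CARD('n)" "a ` I \<subseteq> F" "F = affine hull (a ` I) \<inter> ?P"
      using facet_spanning_indices[OF _ F] by auto
    then have "I \<noteq> {}" by auto
    then obtain i where i: "i \<in> I" by auto
    have fin: "finite I" using I(1) finite_subset by blast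
    have "(i, I - {i}) \<in> ?T"
      using I i fin assms[OF F] by (auto simp: pointed_index_sets_def subset_iff)
    moreover have "F = ?h (i, I - {i})"
      using I(4) i by (simp only: case_prod_conv insert_Diff)
    ultimately show "F \<in> ?h ` ?T" by blast
  qed
  moreover have fin: "finite ?T"
    by (rule finite_subset[OF _ finite_pointed_index_sets]) auto
  ultimately have "card (facets ?P) \<le> card (?h ` ?T)" by (intro card_mono) auto
  also have "\<dots> \<le> card ?T" using fin by (rule card_image_le)
  finally show ?thesis .
qed

lemma dist_facet_vertices_less:
  fixes a :: "nat \<Rightarrow> real ^ 'n"
  assumes n: "CARD('n) \<ge> 2"
    and unit: "\<And>i. i < m \<Longrightarrow> norm (a i) = 1"
    and dense: "\<And>c. norm c = 1 \<Longrightarrow> \<exists>i<m. dist c (a i) < r"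
    and F: "F \<in> facets (convex hull (a ` {..<m}))"
    and ij: "i < m" "j < m" "a i \<in> F" "a j \<in> F"
  shows "dist (a i) (a j) < 2 * r"
proof -
  have "polytope (convex hull (a ` {..<m}))"
    by (intro polytope_convex_hull) auto
  from facet_supporting_hyperplane[OF this F n] obtain c b
    where c: "norm c = 1" "\<And>x. x \<in> convex hull (a ` {..<m}) \<Longrightarrow> c \<bullet> x \<le> b"
      "\<And>x. x \<in> F \<Longrightarrow> c \<bullet> x = b"
    by blast
  obtain k where k: "k < m" "dist c (a k) < r" using dense[OF c(1)] by blast
  \<comment> \<open>For unit vectors, a larger inner product with c means a smaller distance to
    c.\<close>
  have sq: "(dist c (a l))\<^sup>2 = 2 - 2 * (c \<bullet> a l)" if "l < m" for l
    using that c(1) unit[OF that] by (simp add: dist_norm dot_norm_neg field_simps)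
  \<comment> \<open>The sample point near c lies on the inner side of the hyperplane, so the
    vertices on the hyperplane are at least as close to c.\<close>
  have "c \<bullet> a k \<le> b"
    using k by (intro c(2)) (simp add: hull_inc)
  then have "dist c (a l) < r" if "l < m" "a l \<in> F" for l
  proof -
    have "(dist c (a l))\<^sup>2 \<le> (dist c (a k))\<^sup>2"
      using sq[OF that(1)] sq[OF k(1)] c(3)[OF that(2)] \<open>c \<bullet> a k \<le> b\<close> by linarith
    then have "dist c (a l) \<le> dist c (a k)" by (rule power2_le_imp_le) simp
    with k show ?thesis by simp
  qed
  then have "dist c (a i) < r" "dist c (a j) < r" using ij by auto
  then show ?thesis
    using dist_triangle3[of "a i" "a j" c] by linarith
qed

section \<open>Expectations over the random sample\<close>

lemma borel_measurable_miss_ball: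
  fixes g :: "real ^ 'n"
  shows "(\<lambda>a. \<Prod>k<m. indicator (- ball g r) (a k) :: ennreal) \<in> borel_measurable (uniform_sphere_sample m)"
  unfolding uniform_sphere_sample_def
proof (intro borel_measurable_prod_ennreal)
  fix k assume [measurable]: "k \<in> {..<m}"
  show "(\<lambda>a. indicator (- ball g r) (a k) :: ennreal) \<in>
      borel_measurable (PiM {..<m} (\<lambda>_. uniform_sphere))"
    by measurable
qed

text \<open>The event that all sample points avoid the ball is written as a product of indicators,
  so independence splits its integral into m equal factors.\<close>

lemma nn_integral_miss_ball:
  fixes g :: "real ^ 'n"
  assumes p: "p \<le> measure uniform_sphere (ball g r)"
  shows "(\<integral>\<^sup>+ a. (\<Prod>k<m. indicator (- ball g r) (a k)) \<partial>uniform_sphere_sample m) \<le> ennreal ((1 - p) ^ m)"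
proof -
  interpret U: prob_space "uniform_sphere :: (real ^ 'n) measure" by (rule prob_space_uniform_sphere)
  interpret P: product_sigma_finite "\<lambda>_ :: nat. uniform_sphere :: (real ^ 'n) measure"
    by standard
  have "(\<integral>\<^sup>+ a. (\<Prod>k<m. indicator (- ball g r) (a k)) \<partial>uniform_sphere_sample m) =
    (\<Prod>k<m. emeasure uniform_sphere (- ball g r))"
    unfolding uniform_sphere_sample_def by (subst P.product_nn_integral_prod) auto
  also have "emeasure uniform_sphere (- ball g r) = ennreal (1 - measure uniform_sphere (ball g r))"
    using U.prob_compl[of "ball g r"] by (simp add: U.emeasure_eq_measure Compl_eq_Diff_UNIV)
  also have "(\<Prod>k<m. \<dots>) = ennreal ((1 - measure uniform_sphere (ball g r)) ^ m)"
    by (simp add: ennreal_power)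
  also have "\<dots> \<le> ennreal ((1 - p) ^ m)"
    using p by (intro ennreal_leI power_mono) auto
  finally show ?thesis .
qed

lemma borel_measurable_neighbours:
  assumes iJ: "(i, J) \<in> pointed_index_sets m k"
  shows "(\<lambda>a. \<Prod>j\<in>J. if dist (a i) (a j) < r then 1 else (0 :: ennreal))
    \<in> borel_measurable (uniform_sphere_sample m :: (nat \<Rightarrow> real ^ 'n) measure)"
  unfolding uniform_sphere_sample_def
proof (intro borel_measurable_prod_ennreal)
  fix j assume "j \<in> J"
  then have [measurable]: "i \<in> {..<m}" "j \<in> {..<m}"
    using iJ by (auto simp: pointed_index_sets_def)
  show "(\<lambda>a. if dist (a i) (a j) < r then 1 else (0 :: ennreal)) \<in>
      borel_measurable (PiM {..<m} (\<lambda>_. uniform_sphere :: (real ^ 'n) measure))"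
    by measurable
qed

text \<open>With the marked point fixed at y, the k others fall into the ball around y
  independently; the cap bound then holds uniformly in y.\<close>

lemma nn_integral_neighbours:
  assumes q: "\<And>c :: real ^ 'n. norm c = 1 \<Longrightarrow> measure uniform_sphere (ball c r) \<le> q"
    and q0: "q \<ge> 0" and iJ: "(i, J) \<in> pointed_index_sets m k"
  shows "(\<integral>\<^sup>+ a. (\<Prod>j\<in>J. if dist (a i) (a j) < r then 1 else 0)
    \<partial>(uniform_sphere_sample m :: (nat \<Rightarrow> real ^ 'n) measure)) \<le> ennreal (q ^ k)"
proof -
  let ?M = "uniform_sphere :: (real ^ 'n) measure"
  interpret U: prob_space ?M by (rule prob_space_uniform_sphere)
  interpret P: product_sigma_finite "\<lambda>_ :: nat. ?M"
    by standard
  let ?f = "\<lambda>a. \<Prod>j\<in>J. if dist (a i) (a j :: real ^ 'n) < r then 1 else (0 :: ennreal)"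
  define I where "I = {..<m} - {i}"
  have J: "J \<subseteq> I" "card J = k" "i < m" "finite J" "finite I" "i \<notin> I"
    using iJ by (auto simp: I_def pointed_index_sets_def intro: finite_subset)
  have ins: "{..<m} = insert i I" using J by (auto simp: I_def)
  have [measurable]: "?f \<in> borel_measurable (PiM (insert i I) (\<lambda>_. ?M))"
    using borel_measurable_neighbours[OF iJ, of r] ins by (simp add: uniform_sphere_sample_def)
  have inner: "(\<integral>\<^sup>+ x. ?f (x(i := y)) \<partial>PiM I (\<lambda>_. ?M)) = emeasure ?M (ball y r) ^ k" for y
  proof -
    \<comment> \<open>Indices outside J are padded with the factor 1, so that the product runs over
      all coordinates of the product measure.\<close>
    have "?f (x(i := y)) = (\<Prod>j\<in>I. if j \<in> J then indicator (ball y r) (x j) else 1)" for x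
    proof -
      have "?f (x(i := y)) = (\<Prod>j\<in>J. indicator (ball y r) (x j))"
        using J by (intro prod.cong) (auto simp: indicator_def)
      also have "\<dots> = (\<Prod>j\<in>I \<inter> J. indicator (ball y r) (x j))"
        using J by (simp add: Int_absorb1)
      also have "\<dots> = (\<Prod>j\<in>I. if j \<in> J then indicator (ball y r) (x j) else 1)"
        by (subst prod.inter_restrict) (simp_all add: J)
      finally show ?thesis .
    qed
    then have "(\<integral>\<^sup>+ x. ?f (x(i := y)) \<partial>PiM I (\<lambda>_. ?M)) =
        (\<integral>\<^sup>+ x. (\<Prod>j\<in>I. (\<lambda>z. if j \<in> J then indicator (ball y r) z else 1) (x j)) \<partial>PiM I (\<lambda>_. ?M))"
      by simp
    also have "\<dots> = (\<Prod>j\<in>I. \<integral>\<^sup>+ z. (if j \<in> J then indicator (ball y r) z else 1) \<partial>?M)"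
    proof (intro P.product_nn_integral_prod)
      fix j
      show "(\<lambda>z. if j \<in> J then indicator (ball y r) z else 1 :: ennreal) \<in> borel_measurable ?M"
        by (cases "j \<in> J") (simp_all add: borel_measurable_indicator)
    qed (simp add: J)
    also have "\<dots> = (\<Prod>j\<in>I. if j \<in> J then emeasure ?M (ball y r) else 1)"
      using U.emeasure_space_1 by (intro prod.cong) auto
    also have "\<dots> = (\<Prod>j\<in>I \<inter> J. emeasure ?M (ball y r))"
      by (subst prod.inter_restrict) (simp_all add: J)
    also have "\<dots> = emeasure ?M (ball y r) ^ k"
      using J by (simp add: Int_absorb1)
    finally show ?thesis .
  qed
  have "(\<integral>\<^sup>+ a. ?f a \<partial>uniform_sphere_sample m) = (\<integral>\<^sup>+ y. emeasure ?M (ball y r) ^ k \<partial>?M)"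
    \<comment> \<open>The marked coordinate becomes the outer variable y, so \<open>inner\<close>
      applies for each fixed y.\<close>
    unfolding uniform_sphere_sample_def ins
    by (subst P.product_nn_integral_insert_rev) (simp_all only: inner J \<open>?f \<in> _\<close> not_False_eq_True)
  also have "\<dots> \<le> (\<integral>\<^sup>+ y. ennreal (q ^ k) \<partial>?M)"
  proof (rule nn_integral_mono_AE)
    \<comment> \<open>The bound q is known for unit centres only, that is, for almost every
      y.\<close>
    show "AE y in ?M. emeasure ?M (ball y r) ^ k \<le> ennreal (q ^ k)"
      using AE_uniform_sphere
    proof eventually_elim
      case (elim y)
      then have "measure ?M (ball y r) ^ k \<le> q ^ k"
        using q[of y] by (intro power_mono) auto
      then show ?case
        by (simp add: U.emeasure_eq_measure ennreal_power ennreal_leI)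
    qed
  qed
  also have "\<dots> = ennreal (q ^ k)" using U.emeasure_space_1 by simp
  finally show ?thesis .
qed

section \<open>Combining the typical and the exceptional case\<close>

text \<open>Here p bounds caps of radius 1/N from below, and q bounds caps of radius 6/N from above,
  with 7 = 6 + 1. The first summand counts close tuples; the second is the trivial count times a
  union bound over the net.\<close>

lemma expected_facets_le:
  fixes N m :: nat and p q :: real
  defines "n \<equiv> CARD('n)"
  defines "p \<equiv> real N * (1 / (4 * real N)) ^ n"
    and "q \<equiv> (real N + 1) * (7 / real N) ^ n"
  assumes n: "n \<ge> 2" and N: "N > 0"
  shows "(\<integral>\<^sup>+ a. ennreal (real (card (facets (convex hull (a ` {..<m}) :: (real ^ 'n) set))))
      \<partial>uniform_sphere_sample m)
    \<le> ennreal (real m ^ n * (q ^ (n - 1) + real (2 * n * N + 1) ^ n * (1 - p) ^ m))"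
proof -
  let ?M = "uniform_sphere :: (real ^ 'n) measure"
  let ?T = "pointed_index_sets m (n - 1)"
  let ?X = "uniform_sphere_sample m :: (nat \<Rightarrow> real ^ 'n) measure"
  interpret U: prob_space ?M by (rule prob_space_uniform_sphere)
  obtain G0 :: "(real ^ 'n) set" where G0: "finite G0" "card G0 \<le> (2 * n * N + 1) ^ n"
    "\<And>x. norm x \<le> 1 \<Longrightarrow> \<exists>g\<in>G0. dist g x \<le> 1 / real N"
    using unit_ball_net[OF N] unfolding n_def by blast
  \<comment> \<open>Grid points far from the sphere have balls that the sample may never hit. Those
    within 1/N of a unit vector c survive the filter, since their ball of radius 2/N contains the
    cap of radius 1/N around c.\<close>
  define G where "G = {g \<in> G0. p \<le> measure ?M (ball g (2 / real N))}"
  have G: "finite G" "card G \<le> (2 * n * N + 1) ^ n"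
    using G0(1,2) card_mono[of G0 G] by (auto simp: G_def)
  define near where "near = (\<lambda>(i :: nat, J) a. \<Prod>j\<in>J.
    if dist (a i) (a j :: real ^ 'n) < 2 * (3 / real N) then 1 else (0 :: ennreal))"
  define miss where "miss = (\<lambda>g (a :: nat \<Rightarrow> real ^ 'n). \<Prod>k<m. indicator (- ball g (2 / real N)) (a k) :: ennreal)"
  have p1: "p \<le> 1"
  proof -
    have "norm (axis undefined 1 :: real ^ 'n) = 1" by simp
    from measure_uniform_sphere_ball_ge[OF this N] show ?thesis
      unfolding p_def n_def using U.prob_le_1 order_trans by blast
  qed
  have q0: "q \<ge> 0" by (simp add: q_def)
  have q: "measure ?M (ball c (2 * (3 / real N))) \<le> q" if "norm c = 1" for c
    using measure_uniform_sphere_ball_le[OF that N, of 6] by (simp add: q_def n_def)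
  \<comment> \<open>A pointwise majorant covering both cases. Monotonicity of the integral then asks
    for measurability of the majorant alone.\<close>
  have bound: "ennreal (real (card (facets (convex hull (a ` {..<m}))))) \<le>
      (\<Sum>x\<in>?T. near x a) + of_nat (card ?T) * (\<Sum>g\<in>G. miss g a)"
    if unit: "\<forall>i\<in>{..<m}. a i \<in> sphere 0 1" for a :: "nat \<Rightarrow> real ^ 'n"
  proof (cases "\<forall>g\<in>G. \<exists>k<m. a k \<in> ball g (2 / real N)")
    case True
    \<comment> \<open>3/N is 1/N from c to the net point plus 2/N from there to a sample
      point.\<close>
    have dense: "\<exists>i<m. dist c (a i) < 3 / real N" if c: "norm c = 1" for c
    proof -
      obtain g where g: "g \<in> G0" "dist g c \<le> 1 / real N" using G0(3)[of c] c by auto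
      have "ball c (1 / real N) \<subseteq> ball g (2 / real N)"
      proof
        fix x assume "x \<in> ball c (1 / real N)"
        then show "x \<in> ball g (2 / real N)"
          using g(2) dist_triangle[of g x c] by (simp add: field_simps)
      qed
      then have "measure ?M (ball c (1 / real N)) \<le> measure ?M (ball g (2 / real N))"
        by (intro U.finite_measure_mono) auto
      then have "g \<in> G"
        using measure_uniform_sphere_ball_ge[OF c N] g by (simp add: G_def p_def n_def)
      then obtain k where "k < m" "dist g (a k) < 2 / real N" using True by auto
      then show ?thesis
        using g(2) dist_triangle3[of c "a k" g] by (intro exI[of _ k]) (simp add: field_simps)
    qed
    let ?S = "{(i, J) \<in> ?T. \<forall>j\<in>J. dist (a i) (a j) < 2 * (3 / real N)}"
    have "card (facets (convex hull (a ` {..<m}))) \<le> card ?S"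
      unfolding n_def
    proof (rule card_facets_le)
      fix F i j assume "F \<in> facets (convex hull (a ` {..<m}))" "i < m" "j < m" "a i \<in> F" "a j \<in> F"
      then show "dist (a i) (a j) < 2 * (3 / real N)"
        using n unit dense unfolding n_def by (intro dist_facet_vertices_less) auto
    qed
    then have "ennreal (real (card (facets (convex hull (a ` {..<m}))))) \<le> of_nat (card ?S)"
      by (simp add: ennreal_of_nat_eq_real_of_nat)
    also have "\<dots> = (\<Sum>x\<in>?S. 1)" by simp
    also have "\<dots> = (\<Sum>x\<in>?S. near x a)"
      by (intro sum.cong) (auto simp: near_def)
    also have "\<dots> \<le> (\<Sum>x\<in>?T. near x a)"
      by (intro sum_mono2 finite_pointed_index_sets) auto
    also have "\<dots> \<le> \<dots> + of_nat (card ?T) * (\<Sum>g\<in>G. miss g a)"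
      by simp
    finally show ?thesis .
  next
    case False
    then obtain g where g: "g \<in> G" "\<forall>k<m. a k \<notin> ball g (2 / real N)" by blast
    \<comment> \<open>The trivial bound counts all pairs; the missed ball makes one summand
      \<open>miss g a\<close> equal to 1, which pays for it.\<close>
    have "card (facets (convex hull (a ` {..<m}))) \<le> card {(i, J) \<in> ?T. \<forall>j\<in>J. True}"
      unfolding n_def by (rule card_facets_le) simp
    then have "ennreal (real (card (facets (convex hull (a ` {..<m}))))) \<le> of_nat (card ?T) * 1"
      by (simp add: ennreal_of_nat_eq_real_of_nat)
    also have "1 = miss g a"
      using g by (auto simp: miss_def)
    also have "miss g a \<le> (\<Sum>g\<in>G. miss g a)"
      using G(1) g(1) by (intro member_le_sum) auto
    finally have "ennreal (real (card (facets (convex hull (a ` {..<m}))))) \<le>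
      of_nat (card ?T) * (\<Sum>g\<in>G. miss g a)" by (simp add: mult_left_mono)
    then show ?thesis by (rule order_trans) simp
  qed
  have "AE a in ?X. \<forall>i\<in>{..<m}. a i \<in> sphere 0 1"
    unfolding uniform_sphere_sample_def
    by (intro AE_finite_allI AE_PiM_component AE_uniform_sphere prob_space_uniform_sphere) auto
  then have "(\<integral>\<^sup>+ a. ennreal (real (card (facets (convex hull (a ` {..<m}))))) \<partial>?X) \<le>
      (\<integral>\<^sup>+ a. (\<Sum>x\<in>?T. near x a) + of_nat (card ?T) * (\<Sum>g\<in>G. miss g a) \<partial>?X)"
    by (intro nn_integral_mono_AE) (erule eventually_mono, rule bound)
  also have "\<dots> = (\<Sum>x\<in>?T. \<integral>\<^sup>+ a. near x a \<partial>?X) + of_nat (card ?T) * (\<Sum>g\<in>G. \<integral>\<^sup>+ a. miss g a \<partial>?X)"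
  proof -
    have [measurable]: "near x \<in> borel_measurable ?X" if "x \<in> ?T" for x
      using borel_measurable_neighbours that unfolding near_def by (cases x) auto
    have [measurable]: "miss g \<in> borel_measurable ?X" for g
      unfolding miss_def by (rule borel_measurable_miss_ball)
    show ?thesis
      by (simp add: nn_integral_add nn_integral_cmult nn_integral_sum)
  qed
  also have "\<dots> \<le> (\<Sum>x\<in>?T. ennreal (q ^ (n - 1))) + of_nat (card ?T) * (\<Sum>g\<in>G. ennreal ((1 - p) ^ m))"
  proof (intro add_mono mult_left_mono sum_mono)
    fix x assume "x \<in> ?T"
    then show "(\<integral>\<^sup>+ a. near x a \<partial>?X) \<le> ennreal (q ^ (n - 1))"
      using nn_integral_neighbours[OF q q0] by (cases x) (simp add: near_def)
  next
    fix g assume "g \<in> G"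
    then show "(\<integral>\<^sup>+ a. miss g a \<partial>?X) \<le> ennreal ((1 - p) ^ m)"
      unfolding miss_def by (intro nn_integral_miss_ball) (simp add: G_def)
  qed simp
  also have "\<dots> = ennreal (real (card ?T) * (q ^ (n - 1) + real (card G) * (1 - p) ^ m))"
    using q0 p1 by (simp add: ennreal_mult ennreal_plus distrib_left ennreal_of_nat_eq_real_of_nat)
  also have "\<dots> \<le> ennreal (real m ^ n * (q ^ (n - 1) + real (2 * n * N + 1) ^ n * (1 - p) ^ m))"
  proof (intro ennreal_leI mult_mono add_mono)
    have "real (card ?T) \<le> real (m ^ Suc (n - 1))"
      using card_pointed_index_sets_le of_nat_le_iff by blast
    then show "real (card ?T) \<le> real m ^ n" using n by simp
    have "real (card G) \<le> real ((2 * n * N + 1) ^ n)"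
      using G(2) of_nat_le_iff by blast
    then show "real (card G) \<le> real (2 * n * N + 1) ^ n" by simp
  qed (use q0 p1 in auto)
  finally show ?thesis .
qed

section \<open>Choice of N and growth in m\<close>

text \<open>K makes p m at least 2 n ln m, so (1 - p)^m is at most m^(-2n). This cancels one factor
  m^n from the trivial count and one from the size of the net. The lower bracket for N gives m q =
  O(ln m).\<close>

lemma facets_bound_le:
  fixes n m N :: nat and K p q :: real
  defines "p \<equiv> real N * (1 / (4 * real N)) ^ n"
    and "q \<equiv> (real N + 1) * (7 / real N) ^ n"
  assumes n: "n \<ge> 2" and N: "N > 0" and K: "K = 2 * real n * 4 ^ n"
    and m: "ln (real m) \<ge> 1"
    and up: "real N ^ (n - 1) \<le> real m / (K * ln (real m))"
    and low: "real m / (K * ln (real m)) < real (N + 1) ^ (n - 1)"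
    and p1: "p \<le> 1"
  shows "real m ^ n * (q ^ (n - 1) + real (2 * n * N + 1) ^ n * (1 - p) ^ m) \<le>
    ((2 * 7 ^ n * 2 ^ (n - 1) * K) ^ (n - 1) + (3 * real n) ^ n) * ln (real m) ^ (n - 1) * real m"
proof -
  define d where "d = n - 1"
  have nd: "n = Suc d" "d \<ge> 1" using n by (auto simp: d_def)
  let ?L = "ln (real m)"
  have "m > 0" using m by (cases "m = 0") auto
  have m1: "real m \<ge> 1" using \<open>m > 0\<close> by simp
  have K1: "K \<ge> 1"
  proof -
    have "1 * 1 \<le> (2 * real n) * 4 ^ n" using n by (intro mult_mono one_le_power) auto
    then show ?thesis using K by simp
  qed
  have KL: "K * ?L \<ge> 1" using mult_mono[OF K1 m] K1 by simp
  have N1: "real N \<ge> 1" using N by simp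
  have up': "real N ^ d * (K * ?L) \<le> real m"
    using up KL by (simp add: d_def pos_le_divide_eq)
  have low': "real m < real (N + 1) ^ d * (K * ?L)"
    using low KL by (simp add: d_def pos_divide_less_eq)
  have Nd: "real N ^ d > 0" using N by simp
  have mN: "real m / real N ^ d \<le> 2 ^ d * K * ?L"
  proof -
    \<comment> \<open>N + 1 is at most 2N, at the cost of the factor 2^(n-1) in the
      constant.\<close>
    have "real (N + 1) ^ d \<le> (2 * real N) ^ d" using N1 by (intro power_mono) auto
    then have "real (N + 1) ^ d * (K * ?L) \<le> (2 * real N) ^ d * (K * ?L)"
      using KL by (intro mult_right_mono) auto
    then have "real m \<le> (2 * real N) ^ d * (K * ?L)" using low' by linarith
    then show ?thesis using Nd by (simp add: divide_le_eq power_mult_distrib mult_ac)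
  qed
  have mq: "real m * q \<le> (2 * 7 ^ n * 2 ^ d * K) * ?L"
  proof -
    have "real m * q \<le> real m * ((2 * real N) * (7 / real N) ^ n)"
      unfolding q_def using N1 by (intro mult_left_mono mult_right_mono) auto
    also have "\<dots> = 2 * 7 ^ n * (real m / real N ^ d)"
      using N1 by (simp add: nd power_divide)
    also have "\<dots> \<le> 2 * 7 ^ n * (2 ^ d * K * ?L)"
      using mN by (intro mult_left_mono) auto
    finally show ?thesis by (simp add: mult_ac)
  qed
  have q0: "q \<ge> 0" by (simp add: q_def)
  have first: "real m ^ n * q ^ d \<le> (2 * 7 ^ n * 2 ^ d * K) ^ d * ?L ^ d * real m"
  proof -
    have "real m ^ n * q ^ d = (real m * q) ^ d * real m"
      by (simp add: nd power_mult_distrib)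
    also have "\<dots> \<le> ((2 * 7 ^ n * 2 ^ d * K) * ?L) ^ d * real m"
      using mq q0 by (intro mult_right_mono power_mono) auto
    finally show ?thesis by (simp only: power_mult_distrib)
  qed
  have pm: "p * real m \<ge> 2 * real n * ?L"
  proof -
    have "p = 1 / (4 ^ n * real N ^ d)"
      using N1 by (simp add: p_def nd power_divide power_mult_distrib)
    then have "p * real m = real m / real N ^ d / 4 ^ n" by simp
    moreover have "K * ?L \<le> real m / real N ^ d"
      using up' Nd by (simp add: le_divide_eq mult_ac)
    then have "K * ?L / 4 ^ n \<le> real m / real N ^ d / 4 ^ n"
      by (intro divide_right_mono) auto
    ultimately show ?thesis by (simp add: K)
  qed
  \<comment> \<open>Uses 1 - p <= exp(-p), raised to the power m.\<close>
  have pw: "real m ^ (2 * n) * (1 - p) ^ m \<le> 1"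
  proof -
    have "(1 - p) ^ m \<le> exp (- p) ^ m"
      using p1 exp_ge_add_one_self[of "- p"] by (intro power_mono) auto
    also have "\<dots> = exp (- (p * real m))" by (simp add: exp_of_nat_mult[symmetric] mult_ac)
    also have "\<dots> \<le> exp (- (real (2 * n) * ?L))" using pm by simp
    also have "\<dots> = inverse (real m ^ (2 * n))"
      using m1 by (simp only: exp_minus exp_of_nat_mult) simp
    finally show ?thesis using m1 by (simp add: field_simps)
  qed
  \<comment> \<open>N is at most m, so the net has size polynomial in m.\<close>
  have "real N ^ 1 \<le> real N ^ d" using N1 nd by (intro power_increasing) auto
  also have "\<dots> = real N ^ d * 1" by simp
  also have "\<dots> \<le> real N ^ d * (K * ?L)" using KL Nd by (intro mult_left_mono) auto
  finally have Nm: "real N \<le> real m" using up' by simp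
  have "real (2 * n * N + 1) \<le> 3 * real n * real N"
  proof -
    have "1 * 1 \<le> real n * real N" using n N1 by (intro mult_mono) auto
    then show ?thesis by (simp add: mult_ac)
  qed
  also have "\<dots> \<le> 3 * real n * real m" using Nm by (intro mult_left_mono) auto
  finally have "real (2 * n * N + 1) ^ n \<le> (3 * real n * real m) ^ n" by (intro power_mono) auto
  then have "real m ^ n * (real (2 * n * N + 1) ^ n * (1 - p) ^ m) \<le>
      real m ^ n * ((3 * real n * real m) ^ n * (1 - p) ^ m)"
    using p1 by (intro mult_left_mono mult_right_mono) auto
  also have "\<dots> = (3 * real n) ^ n * (real m ^ (2 * n) * (1 - p) ^ m)"
    by (simp add: power_mult_distrib mult_2 power_add)
  also have "\<dots> \<le> (3 * real n) ^ n * 1" using pw by (intro mult_left_mono) auto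
  also have "\<dots> \<le> (3 * real n) ^ n * (?L ^ d * real m)"
  proof -
    \<comment> \<open>The exceptional term is bounded by a constant, which the main term absorbs
      because both factors are at least 1.\<close>
    have "1 * 1 \<le> ?L ^ d * real m" using m m1 by (intro mult_mono one_le_power) auto
    then show ?thesis by (intro mult_left_mono) auto
  qed
  finally show ?thesis using first
    unfolding d_def[symmetric] by (simp add: algebra_simps)
qed

lemma ex_nat_power_bracket:
  fixes M :: real
  assumes "d > 0" "M \<ge> 1"
  obtains N :: nat where "N > 0" "real N ^ d \<le> M" "M < real (N + 1) ^ d"
proof -
  define x where "x = root d M"
  have x: "x \<ge> 1" "x ^ d = M" using assms by (auto simp: x_def real_root_pow_pos2)
  define N where "N = nat \<lfloor>x\<rfloor>"
  have N: "real N \<le> x" "x < real (N + 1)" "N > 0"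
    using x unfolding N_def by linarith+
  show ?thesis
  proof (rule that)
    show "real N ^ d \<le> M" using N power_mono[of "real N" x d] x by simp
    show "M < real (N + 1) ^ d" using N power_strict_mono[of x "real (N + 1)" d] x assms by simp
  qed (use N in simp)
qed

theorem theorem1:
  assumes "CARD('n::finite) \<ge> 2"
  shows "\<exists>C::real. eventually (\<lambda>m::nat.
    (\<integral>\<^sup>+ a. ennreal (real (card (facets (convex hull (a ` {..<m}) :: (real ^ 'n) set))))
       \<partial>uniform_sphere_sample m)
    \<le> ennreal (C * ln (real m) ^ (CARD('n) - 1) * real m)) sequentially"
proof -
  define n where "n = CARD('n)"
  define K where "K = 2 * real n * 4 ^ n"
  have n: "n \<ge> 2" using assms by (simp add: n_def)
  then have K: "K > 0" by (simp add: K_def)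
  \<comment> \<open>Makes room for a positive integer N in the bracket.\<close>
  have "eventually (\<lambda>m::nat. real m / (K * ln (real m)) \<ge> 1) sequentially"
    using K by real_asymp
  moreover have "eventually (\<lambda>m::nat. ln (real m) \<ge> 1) sequentially"
    by real_asymp
  ultimately have "eventually (\<lambda>m::nat.
    (\<integral>\<^sup>+ a. ennreal (real (card (facets (convex hull (a ` {..<m}) :: (real ^ 'n) set))))
       \<partial>uniform_sphere_sample m)
    \<le> ennreal (((2 * 7 ^ n * 2 ^ (n - 1) * K) ^ (n - 1) + (3 * real n) ^ n) *
      ln (real m) ^ (n - 1) * real m)) sequentially"
  proof eventually_elim
    case (elim m)
    obtain N :: nat where N: "N > 0" "real N ^ (n - 1) \<le> real m / (K * ln (real m))"
      "real m / (K * ln (real m)) < real (N + 1) ^ (n - 1)"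
      using ex_nat_power_bracket[of "n - 1"] elim n by (metis diff_is_0_eq not_gr_zero not_less_eq_eq one_add_one plus_1_eq_Suc)
    \<comment> \<open>Lowering the exponent from n to 1 leaves N/(4N) = 1/4.\<close>
    have p1: "real N * (1 / (4 * real N)) ^ n \<le> 1"
    proof -
      have "real N * (1 / (4 * real N)) ^ n \<le> real N * (1 / (4 * real N)) ^ 1"
        using N n by (intro mult_left_mono power_decreasing) auto
      also have "\<dots> \<le> 1" using N by simp
      finally show ?thesis .
    qed
    show ?case
      by (rule order_trans[OF expected_facets_le[where 'n='n, folded n_def, OF n N(1)]])
        (rule ennreal_leI[OF facets_bound_le[OF n N(1) K_def elim(2) N(2,3) p1]])
  qed
  then show ?thesis unfolding n_def by blast
qed

end
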